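(* Let $\omega=e^{2\pi i/3}$ and let $\alpha\in\mathbb{Z}[\omega]$ be an odd norm-perfect Eisenstein integer. For $j\in\{1,2\}$ let $P_j=\{\psi\in\mathbb{P}^+:\ \psi\equiv j \pmod{1-\omega^2},\ \psi\mid\alpha\}$. Then $\alpha$ has the form $$\alpha=\varepsilon\,\psi_0^k\prod_{\psi_1\in P_1,\,\psi_1\ne\psi_0}\psi_1^{e_{\psi_1}}\prod_{\psi_2\in P_2,\,\psi_2\ne\psi_0}\psi_2^{e_{\psi_2}}$$ with $\varepsilon$ a unit, where either (1) $\psi_0\in P_1$ and $k\equiv 2\pmod 3$, or (2) $\psi_0\in P_2$ and $k\equiv 1\pmod 2$; and moreover $e_{\psi_1}\not\equiv 2\pmod 3$ for all the $\psi_1$ in the product and $e_{\psi_2}\equiv 0\pmod 2$ for all the $\psi_2$ in the product.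
   Context: $\mathbb{Z}[\omega]$ is a UFD with norm $N(a+b\omega)=a^2-ab+b^2$, and $\mathbb{Z}[\omega]/(1-\omega^2)\cong\mathbb{Z}/3\mathbb{Z}$. The positive primes are $\mathbb{P}^+=\{a+b\omega: a>b\ge 0\}\cap\{\text{primes of }\mathbb{Z}[\omega]\}$. For nonzero $\alpha=\varepsilon\prod\pi_j^{e_j}$ ($\varepsilon$ a unit, distinct $\pi_j\in\mathbb{P}^+$), $\sigma(\alpha)=\prod\frac{\pi_j^{e_j+1}-1}{\pi_j-1}$. $\alpha$ is odd if $(1-\omega^2)\nmid\alpha$. $\alpha$ is norm-perfect if $N(\sigma(\alpha))=3N(\alpha)$. *)

theory Defs
  imports Complex_Main "HOL-Library.Centered_Division"
    "HOL-Computational_Algebra.Euclidean_Algorithm" "HOL-Number_Theory.Cong"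
begin

section \<open>The ring of Eisenstein integers\<close>

text \<open>
  \<open>Eisenstein a b\<close> represents \<open>a + b \<omega>\<close>. The ring structure comes from \<open>\<omega>\<^sup>2 = -1 - \<omega>\<close>;
  \<open>complex_of_eisenstein\<close> below identifies the type with the subring \<open>\<int>[exp (2 \<pi> \<i> / 3)]\<close>
  of the complex numbers.
\<close>

codatatype eisenstein = Eisenstein (int_part: int) (omega_part: int)

lemma eisenstein_eqI [intro?]:
  "x = y" if "int_part x = int_part y" "omega_part x = omega_part y"
  by (rule eisenstein.expand) (use that in simp)

lemma eisenstein_eq_iff:
  "x = y \<longleftrightarrow> int_part x = int_part y \<and> omega_part x = omega_part y"
  by (auto intro: eisenstein_eqI)

instantiation eisenstein :: comm_ring_1
begin

primcorec zero_eisenstein :: eisenstein where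
  "int_part 0 = 0"
| "omega_part 0 = 0"

primcorec one_eisenstein :: eisenstein where
  "int_part 1 = 1"
| "omega_part 1 = 0"

primcorec plus_eisenstein :: "eisenstein \<Rightarrow> eisenstein \<Rightarrow> eisenstein" where
  "int_part (x + y) = int_part x + int_part y"
| "omega_part (x + y) = omega_part x + omega_part y"

primcorec uminus_eisenstein :: "eisenstein \<Rightarrow> eisenstein" where
  "int_part (- x) = - int_part x"
| "omega_part (- x) = - omega_part x"

primcorec minus_eisenstein :: "eisenstein \<Rightarrow> eisenstein \<Rightarrow> eisenstein" where
  "int_part (x - y) = int_part x - int_part y"
| "omega_part (x - y) = omega_part x - omega_part y"

primcorec times_eisenstein :: "eisenstein \<Rightarrow> eisenstein \<Rightarrow> eisenstein" where
  "int_part (x * y) = int_part x * int_part y - omega_part x * omega_part y"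
| "omega_part (x * y) =
     int_part x * omega_part y + omega_part x * int_part y - omega_part x * omega_part y"

instance
  by standard (simp_all add: eisenstein_eq_iff algebra_simps)

end

primcorec eisenstein_omega :: eisenstein where
  "int_part eisenstein_omega = 0"
| "omega_part eisenstein_omega = 1"

definition eisenstein_norm :: "eisenstein \<Rightarrow> int" where
  "eisenstein_norm x = (int_part x)\<^sup>2 - int_part x * omega_part x + (omega_part x)\<^sup>2"

lemma eisenstein_of_nat: "of_nat n = Eisenstein (int n) 0"
  by (induction n) (simp_all add: eisenstein_eq_iff)

lemma eisenstein_of_int: "of_int k = Eisenstein k 0"
  by (simp add: eisenstein_eq_iff of_int_of_nat eisenstein_of_nat)

lemma Eisenstein_eq: "Eisenstein a b = of_int a + of_int b * eisenstein_omega"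
  by (simp add: eisenstein_eq_iff eisenstein_of_int)

lemma eisenstein_norm_mult: "eisenstein_norm (x * y) = eisenstein_norm x * eisenstein_norm y"
  by (simp add: eisenstein_norm_def power2_eq_square algebra_simps)

lemma eisenstein_norm_times_4:
  "4 * eisenstein_norm x = (2 * int_part x - omega_part x)\<^sup>2 + 3 * (omega_part x)\<^sup>2"
  by (simp add: eisenstein_norm_def power2_eq_square algebra_simps)

lemma eisenstein_norm_nonneg: "0 \<le> eisenstein_norm x"
proof -
  have "0 \<le> 4 * eisenstein_norm x"
    unfolding eisenstein_norm_times_4 by simp
  then show ?thesis
    by simp
qed

lemma eisenstein_norm_eq_0_iff: "eisenstein_norm x = 0 \<longleftrightarrow> x = 0"
proof
  assume "eisenstein_norm x = 0"
  then have "(2 * int_part x - omega_part x)\<^sup>2 + 3 * (omega_part x)\<^sup>2 = 0"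
    by (simp flip: eisenstein_norm_times_4)
  then have "(2 * int_part x - omega_part x)\<^sup>2 = 0" "(omega_part x)\<^sup>2 = 0"
    using zero_le_power2 [of "2 * int_part x - omega_part x"] zero_le_power2 [of "omega_part x"]
    by linarith+
  then show "x = 0"
    by (simp add: eisenstein_eq_iff)
qed (simp add: eisenstein_norm_def)

lemma eisenstein_norm_pos: "x \<noteq> 0 \<Longrightarrow> 0 < eisenstein_norm x"
  using eisenstein_norm_nonneg [of x] eisenstein_norm_eq_0_iff [of x] by linarith

instance eisenstein :: idom
proof
  fix x y :: eisenstein
  assume "x \<noteq> 0" "y \<noteq> 0"
  then have "eisenstein_norm (x * y) \<noteq> 0"
    by (simp add: eisenstein_norm_mult eisenstein_norm_eq_0_iff)
  then show "x * y \<noteq> 0"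
    by (simp add: eisenstein_norm_eq_0_iff)
qed


subsection \<open>Embedding into the complex numbers\<close>

definition complex_of_eisenstein :: "eisenstein \<Rightarrow> complex" where
  "complex_of_eisenstein x =
     of_int (int_part x) + of_int (omega_part x) * exp (2 * of_real pi * \<i> / 3)"

lemma exp_2_pi_i_third: "exp (2 * of_real pi * \<i> / 3) = Complex (- 1 / 2) (sqrt 3 / 2)"
proof -
  have "exp (2 * of_real pi * \<i> / 3) = cis (2 * pi / 3)"
    by (simp add: cis_conv_exp mult_ac)
  also have "2 * pi / 3 = pi - pi / 3"
    by simp
  also have "cis \<dots> = Complex (- 1 / 2) (sqrt 3 / 2)"
    by (simp only: cis.ctr cos_diff sin_diff) (simp add: cos_60 sin_60)
  finally show ?thesis .
qed

lemma complex_of_eisenstein_omega [simp]: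
  "complex_of_eisenstein eisenstein_omega = exp (2 * of_real pi * \<i> / 3)"
  by (simp add: complex_of_eisenstein_def)

lemma complex_of_eisenstein_0 [simp]: "complex_of_eisenstein 0 = 0"
  and complex_of_eisenstein_1 [simp]: "complex_of_eisenstein 1 = 1"
  by (simp_all add: complex_of_eisenstein_def)

lemma complex_of_eisenstein_add [simp]:
  "complex_of_eisenstein (x + y) = complex_of_eisenstein x + complex_of_eisenstein y"
  by (simp add: complex_of_eisenstein_def algebra_simps)

lemma complex_of_eisenstein_mult [simp]:
  "complex_of_eisenstein (x * y) = complex_of_eisenstein x * complex_of_eisenstein y"
  unfolding complex_of_eisenstein_def exp_2_pi_i_third
  by (simp add: complex_eq_iff algebra_simps)

lemma inj_complex_of_eisenstein: "inj complex_of_eisenstein"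
proof (rule injI)
  fix x y
  assume *: "complex_of_eisenstein x = complex_of_eisenstein y"
  then have "omega_part x = omega_part y"
    unfolding complex_of_eisenstein_def exp_2_pi_i_third by (simp add: complex_eq_iff)
  with * show "x = y"
    by (simp add: complex_of_eisenstein_def eisenstein_eq_iff)
qed

lemma range_complex_of_eisenstein:
  "range complex_of_eisenstein =
     {of_int a + of_int b * exp (2 * of_real pi * \<i> / 3) | a b. True}"
proof -
  have "of_int a + of_int b * exp (2 * of_real pi * \<i> / 3) \<in> range complex_of_eisenstein"
    for a b
    by (rule range_eqI [of _ _ "Eisenstein a b"]) (simp add: complex_of_eisenstein_def)
  then show ?thesis
    by (auto simp: complex_of_eisenstein_def)
qed

lemma eisenstein_norm_conv_norm:
  "of_int (eisenstein_norm x) = (norm (complex_of_eisenstein x))\<^sup>2"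
  unfolding complex_of_eisenstein_def exp_2_pi_i_third cmod_power2
  by (simp add: eisenstein_norm_def power2_eq_square field_simps)


subsection \<open>Euclidean division\<close>

text \<open>
  The quotient rounds the coordinates of \<open>x / y = x * y\<^sup>* / N(y)\<close>, where \<open>y\<^sup>*\<close> is the complex
  conjugate of \<open>y\<close>.
\<close>

primcorec eisenstein_cnj :: "eisenstein \<Rightarrow> eisenstein" where
  "int_part (eisenstein_cnj x) = int_part x - omega_part x"
| "omega_part (eisenstein_cnj x) = - omega_part x"

lemma eisenstein_mult_cnj: "x * eisenstein_cnj x = of_int (eisenstein_norm x)"
  by (simp add: eisenstein_eq_iff eisenstein_of_int eisenstein_norm_def power2_eq_square
      algebra_simps)

lemma eisenstein_norm_cnj: "eisenstein_norm (eisenstein_cnj x) = eisenstein_norm x"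
  by (simp add: eisenstein_norm_def power2_eq_square algebra_simps)

lemma eisenstein_norm_of_int: "eisenstein_norm (of_int k) = k\<^sup>2"
  by (simp add: eisenstein_norm_def eisenstein_of_int)

instantiation eisenstein :: idom_modulo
begin

primcorec divide_eisenstein :: "eisenstein \<Rightarrow> eisenstein \<Rightarrow> eisenstein" where
  "int_part (x div y) = int_part (x * eisenstein_cnj y) cdiv eisenstein_norm y"
| "omega_part (x div y) = omega_part (x * eisenstein_cnj y) cdiv eisenstein_norm y"

definition modulo_eisenstein :: "eisenstein \<Rightarrow> eisenstein \<Rightarrow> eisenstein" where
  "modulo_eisenstein x y = x - x div y * y"

instance
proof
  fix x y :: eisenstein
  show "x div 0 = 0"
    by (simp add: eisenstein_eq_iff eisenstein_norm_def)
  show "x * y div y = x" if "y \<noteq> 0"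
  proof -
    have "x * y * eisenstein_cnj y = x * of_int (eisenstein_norm y)"
      by (simp add: mult.assoc eisenstein_mult_cnj)
    with eisenstein_norm_pos [OF that] show ?thesis
      by (simp add: eisenstein_eq_iff del: times_eisenstein.simps)
        (simp add: eisenstein_of_int nonzero_mult_cdiv_cancel_right)
  qed
  show "x div y * y + x mod y = x"
    by (simp add: modulo_eisenstein_def)
qed

end

instantiation eisenstein :: euclidean_ring
begin

definition euclidean_size_eisenstein :: "eisenstein \<Rightarrow> nat" where
  "euclidean_size x = nat (eisenstein_norm x)"

instance
proof
  fix x y :: eisenstein
  show "euclidean_size (0 :: eisenstein) = 0"
    by (simp add: euclidean_size_eisenstein_def eisenstein_norm_def)
  assume "y \<noteq> 0"
  define n where "n = eisenstein_norm y"
  have "0 < n"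
    using \<open>y \<noteq> 0\<close> by (simp add: n_def eisenstein_norm_pos)
  show "euclidean_size x \<le> euclidean_size (x * y)"
    using mult_left_mono [of 1 n "eisenstein_norm x"] \<open>0 < n\<close> eisenstein_norm_nonneg [of x]
    by (simp add: euclidean_size_eisenstein_def eisenstein_norm_mult n_def nat_mono)
  show "euclidean_size (x mod y) < euclidean_size y"
  proof -
    define z where "z = x * eisenstein_cnj y"
    define r s where "r = int_part z cmod n" and "s = omega_part z cmod n"
    have "x mod y * eisenstein_cnj y = z - x div y * of_int n"
      by (simp add: modulo_eisenstein_def z_def n_def left_diff_distrib mult.assoc
          eisenstein_mult_cnj del: times_eisenstein.simps)
    also have "\<dots> = Eisenstein r s"
      by (simp add: eisenstein_eq_iff eisenstein_of_int r_def s_def z_def n_def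
          minus_cdiv_mult_eq_cmod)
    finally have "eisenstein_norm (x mod y * eisenstein_cnj y) = r\<^sup>2 - r * s + s\<^sup>2"
      by (simp add: eisenstein_norm_def)
    then have "eisenstein_norm (x mod y) * n = r\<^sup>2 - r * s + s\<^sup>2"
      by (simp add: eisenstein_norm_mult eisenstein_norm_cnj n_def)
    moreover have "r\<^sup>2 - r * s + s\<^sup>2 < n * n"
    proof -
      have "2 * \<bar>r\<bar> \<le> n" "2 * \<bar>s\<bar> \<le> n"
        using \<open>0 < n\<close> abs_cmod_less_equal [of n "int_part z"]
          abs_cmod_less_equal [of n "omega_part z"] unfolding r_def s_def by linarith+
      then have "(2 * \<bar>r\<bar>) * (2 * \<bar>r\<bar>) \<le> n * n" "(2 * \<bar>s\<bar>) * (2 * \<bar>s\<bar>) \<le> n * n"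
        "(2 * \<bar>r\<bar>) * (2 * \<bar>s\<bar>) \<le> n * n"
        using \<open>0 < n\<close> by (intro mult_mono; simp)+
      moreover have "- (r * s) \<le> \<bar>r\<bar> * \<bar>s\<bar>"
        by (simp flip: abs_mult)
      moreover have "0 < n * n"
        using \<open>0 < n\<close> by simp
      moreover have "\<bar>r\<bar> * \<bar>r\<bar> = r\<^sup>2" "\<bar>s\<bar> * \<bar>s\<bar> = s\<^sup>2"
        by (simp_all add: power2_eq_square)
      ultimately show ?thesis
        by simp
    qed
    ultimately have "eisenstein_norm (x mod y) < n"
      using \<open>0 < n\<close> by (metis mult_less_cancel_right_pos)
    then show ?thesis
      using \<open>0 < n\<close> by (simp add: euclidean_size_eisenstein_def n_def)
  qed
qed

end



subsection \<open>Units, positive elements and unique factorisation\<close>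

lemma eisenstein_is_unit_iff_norm: "is_unit x \<longleftrightarrow> eisenstein_norm x = 1" for x :: eisenstein
proof
  assume "is_unit x"
  then obtain y where "1 = x * y" ..
  then have "eisenstein_norm x * eisenstein_norm y = eisenstein_norm 1"
    by (simp only: flip: eisenstein_norm_mult)
  then have "eisenstein_norm x * eisenstein_norm y = 1"
    by (simp add: eisenstein_norm_def)
  with eisenstein_norm_nonneg [of x] show "eisenstein_norm x = 1"
    by (simp add: zmult_eq_1_iff)
next
  assume "eisenstein_norm x = 1"
  then have "1 = x * eisenstein_cnj x"
    by (simp only: eisenstein_mult_cnj of_int_1)
  then show "is_unit x" ..
qed

lemma eisenstein_is_unit_iff:
  "is_unit x \<longleftrightarrow> x \<in> {Eisenstein 1 0, Eisenstein 1 1, Eisenstein 0 1,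
     Eisenstein (- 1) 0, Eisenstein (- 1) (- 1), Eisenstein 0 (- 1)}"
proof
  assume "is_unit x"
  then have 1: "eisenstein_norm x = 1"
    by (simp add: eisenstein_is_unit_iff_norm)
  have abs_le: "\<bar>v\<bar> \<le> 1" if "u\<^sup>2 + 3 * v\<^sup>2 = 4" for u v :: int
  proof (rule ccontr)
    assume "\<not> \<bar>v\<bar> \<le> 1"
    then have "2\<^sup>2 \<le> \<bar>v\<bar>\<^sup>2"
      by (intro power_mono) auto
    with that show False
      using zero_le_power2 [of u] by simp
  qed
  have "\<bar>omega_part x\<bar> \<le> 1"
    by (rule abs_le [of "2 * int_part x - omega_part x"])
      (use eisenstein_norm_times_4 [of x] 1 in simp)
  moreover have "\<bar>int_part x\<bar> \<le> 1"
    by (rule abs_le [of "2 * omega_part x - int_part x"])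
      (use 1 in \<open>simp add: eisenstein_norm_def power2_eq_square algebra_simps\<close>)
  ultimately have "int_part x \<in> {-1, 0, 1}" "omega_part x \<in> {-1, 0, 1}"
    by auto
  with 1 show "x \<in> {Eisenstein 1 0, Eisenstein 1 1, Eisenstein 0 1,
     Eisenstein (- 1) 0, Eisenstein (- 1) (- 1), Eisenstein 0 (- 1)}"
    by (auto simp: eisenstein_eq_iff eisenstein_norm_def)
qed (auto simp: eisenstein_is_unit_iff_norm eisenstein_norm_def)

definition positive_eisenstein :: "eisenstein set" where
  "positive_eisenstein = {Eisenstein a b | a b. a > b \<and> b \<ge> 0}"

lemma positive_eisenstein_iff:
  "x \<in> positive_eisenstein \<longleftrightarrow> omega_part x < int_part x \<and> 0 \<le> omega_part x"
  unfolding positive_eisenstein_def by (cases x) auto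

lemma ex_positive_eisenstein:
  assumes "x \<noteq> 0"
  obtains u y where "is_unit u" "y \<in> positive_eisenstein" "x = u * y"
proof -
  define us where "us = [Eisenstein 1 0, Eisenstein 1 1, Eisenstein 0 1,
     Eisenstein (- 1) 0, Eisenstein (- 1) (- 1), Eisenstein 0 (- 1)]"
  have "\<exists>v \<in> set us. v * x \<in> positive_eisenstein"
    using assms unfolding us_def positive_eisenstein_iff eisenstein_eq_iff list.set bex_simps
    by simp linarith
  then obtain v where "is_unit v" "v * x \<in> positive_eisenstein"
    by (auto simp: us_def eisenstein_is_unit_iff)
  then obtain u where "1 = v * u"
    by blast
  then have "x = u * (v * x)"
    by (metis mult.assoc mult.commute mult_1)
  moreover have "is_unit u"
    using \<open>1 = v * u\<close> by (metis dvd_triv_right)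
  ultimately show thesis
    using that \<open>v * x \<in> positive_eisenstein\<close> by blast
qed

lemma positive_eisenstein_unique:
  assumes "is_unit u" "y \<in> positive_eisenstein" "u * y \<in> positive_eisenstein"
  shows "u = 1"
  using assms by (auto simp: eisenstein_is_unit_iff positive_eisenstein_iff eisenstein_eq_iff)

lemma positive_eisenstein_unique':
  assumes "is_unit u" "is_unit v" "y \<in> positive_eisenstein" "z \<in> positive_eisenstein"
    and "u * y = v * z"
  shows "u = v"
proof -
  from \<open>is_unit v\<close> obtain w where w: "1 = v * w" ..
  have "w * u * y = z"
    using assms(5) w by (metis mult.assoc mult.commute mult_1)
  moreover have "is_unit w"
    using w by (metis dvd_triv_right)
  ultimately have "w * u = 1"
    using positive_eisenstein_unique [of "w * u" y] unit_prod [of w u] assms by simp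
  with w show ?thesis
    by (metis mult.assoc mult.commute mult_1)
qed

instantiation eisenstein :: normalization_euclidean_semiring
begin

definition unit_factor_eisenstein :: "eisenstein \<Rightarrow> eisenstein" where
  "unit_factor x =
     (if x = 0 then 0 else THE u. is_unit u \<and> (\<exists>y \<in> positive_eisenstein. x = u * y))"

definition normalize_eisenstein :: "eisenstein \<Rightarrow> eisenstein" where
  "normalize_eisenstein x = x div unit_factor x"

lemma unit_factor_eisenstein_eqI:
  assumes "is_unit u" "y \<in> positive_eisenstein"
  shows "unit_factor (u * y) = u"
proof -
  have "u * y \<noteq> 0"
    using assms by (auto simp: positive_eisenstein_iff)
  moreover have "(THE v. is_unit v \<and> (\<exists>z \<in> positive_eisenstein. u * y = v * z)) = u"
    using assms by (intro the_equality) (auto dest: positive_eisenstein_unique')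
  ultimately show ?thesis
    by (simp add: unit_factor_eisenstein_def)
qed

instance
proof
  fix x y :: eisenstein
  show "unit_factor (0 :: eisenstein) = 0"
    by (simp add: unit_factor_eisenstein_def)
  show "normalize (0 :: eisenstein) = 0"
    by (simp add: normalize_eisenstein_def)
  show unit: "is_unit (unit_factor x)" if "x \<noteq> 0" for x :: eisenstein
    using that by (metis ex_positive_eisenstein unit_factor_eisenstein_eqI)
  show "unit_factor x * normalize x = x"
  proof (cases "x = 0")
    case False
    then have "unit_factor x dvd x"
      using unit unit_imp_dvd by blast
    then show ?thesis
      by (simp add: normalize_eisenstein_def del: times_eisenstein.simps)
  qed (simp add: normalize_eisenstein_def)
  show "unit_factor x = x" if "is_unit x"
  proof -
    have "1 \<in> positive_eisenstein"
      by (simp add: positive_eisenstein_iff)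
    with unit_factor_eisenstein_eqI [OF that] show ?thesis
      by (metis mult_1_right)
  qed
  show "unit_factor (x * y) = x * unit_factor y" if "is_unit x"
  proof (cases "y = 0")
    case True
    then show ?thesis
      by (simp add: unit_factor_eisenstein_def)
  next
    case False
    then obtain u z where "is_unit u" "z \<in> positive_eisenstein" "y = u * z"
      by (rule ex_positive_eisenstein)
    with that show ?thesis
      using unit_factor_eisenstein_eqI [of u z] unit_factor_eisenstein_eqI [of "x * u" z]
        unit_prod [of x u]
      by (simp add: mult.assoc)
  qed
qed

end


section \<open>Norm-perfect Eisenstein integers\<close>

definition positive_primes :: "eisenstein set" where
  "positive_primes = positive_eisenstein \<inter> {\<pi>. prime_elem \<pi>}"

lemma normalize_eisenstein_eq_self_iff:
  "normalize x = x \<longleftrightarrow> x = 0 \<or> x \<in> positive_eisenstein" for x :: eisenstein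
proof (cases "x = 0")
  case False
  then obtain u y where *: "is_unit u" "y \<in> positive_eisenstein" "x = u * y"
    by (rule ex_positive_eisenstein)
  then have "unit_factor x = u"
    using unit_factor_eisenstein_eqI by blast
  then have "normalize x = y"
    using * unit_factor_mult_normalize [of x] by (metis mult_cancel_left not_is_unit_0)
  then show ?thesis
    using * False positive_eisenstein_unique by (metis mult_1)
qed simp

lemma positive_primes_eq: "positive_primes = {\<pi>. prime \<pi>}"
  by (auto simp: positive_primes_def prime_def normalize_eisenstein_eq_self_iff)

text \<open>
  The quotients are exact (cf. \<open>eisenstein_geometric_quotient\<close>). Only nonzero arguments are
  meaningful. \<open>eisenstein_sigma_factorisation\<close> gives the value in terms of an explicit
  factorisation.
\<close>

definition eisenstein_sigma :: "eisenstein \<Rightarrow> eisenstein" where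
  "eisenstein_sigma \<alpha> =
     (\<Prod>\<pi> \<in> {\<pi> \<in> positive_primes. \<pi> dvd \<alpha>}. (\<pi> ^ (multiplicity \<pi> \<alpha> + 1) - 1) div (\<pi> - 1))"

lemma eisenstein_geometric_quotient:
  fixes \<pi> :: eisenstein
  assumes "\<pi> \<noteq> 1"
  shows "(\<pi> ^ (n + 1) - 1) div (\<pi> - 1) = (\<Sum>i\<le>n. \<pi> ^ i)"
proof -
  have "\<pi> ^ (n + 1) - 1 = (\<pi> - 1) * (\<Sum>i\<le>n. \<pi> ^ i)"
    using power_diff_1_eq [of \<pi> "Suc n"] by (simp add: lessThan_Suc_atMost)
  with assms show ?thesis
    by simp
qed

lemma eisenstein_sigma_factorisation:
  assumes "finite S" "S \<subseteq> positive_primes" "is_unit \<epsilon>" "\<And>\<pi>. \<pi> \<in> S \<Longrightarrow> e \<pi> > 0"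
  shows "eisenstein_sigma (\<epsilon> * (\<Prod>\<pi>\<in>S. \<pi> ^ e \<pi>)) =
           (\<Prod>\<pi>\<in>S. (\<pi> ^ (e \<pi> + 1) - 1) div (\<pi> - 1))"
proof -
  let ?\<alpha> = "\<epsilon> * (\<Prod>\<pi>\<in>S. \<pi> ^ e \<pi>)"
  have prime: "prime \<pi>" if "\<pi> \<in> S" for \<pi>
    using that assms(2) by (auto simp: positive_primes_eq)
  then have "?\<alpha> \<noteq> 0"
    using assms(1,3) by (metis mult_eq_0_iff not_is_unit_0 not_prime_0 power_eq_0_iff prod_zero_iff)
  have mult: "multiplicity \<pi> ?\<alpha> = (if \<pi> \<in> S then e \<pi> else 0)" if "prime \<pi>" for \<pi>
    using that assms(1,3) prime
    by (simp add: multiplicity_times_unit_right multiplicity_prod_prime_powers)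
  have "\<pi> dvd ?\<alpha> \<longleftrightarrow> \<pi> \<in> S" if "prime \<pi>" for \<pi>
    using mult [OF that] that assms(4) \<open>?\<alpha> \<noteq> 0\<close> prime_multiplicity_gt_zero_iff [of \<pi> ?\<alpha>]
    by (auto split: if_splits)
  then have "{\<pi> \<in> positive_primes. \<pi> dvd ?\<alpha>} = S"
    using prime by (auto simp: positive_primes_eq)
  then show ?thesis
    unfolding eisenstein_sigma_def by (intro prod.cong) (simp_all add: mult prime)
qed

definition odd_eisenstein :: "eisenstein \<Rightarrow> bool" where
  "odd_eisenstein \<alpha> \<longleftrightarrow> \<not> (1 - eisenstein_omega\<^sup>2) dvd \<alpha>"

definition norm_perfect :: "eisenstein \<Rightarrow> bool" where
  "norm_perfect \<alpha> \<longleftrightarrow> eisenstein_norm (eisenstein_sigma \<alpha>) = 3 * eisenstein_norm \<alpha>"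

definition prime_divisors_mod :: "nat \<Rightarrow> eisenstein \<Rightarrow> eisenstein set" where
  "prime_divisors_mod j \<alpha> =
     {\<psi> \<in> positive_primes. (1 - eisenstein_omega\<^sup>2) dvd (\<psi> - of_nat j) \<and> \<psi> dvd \<alpha>}"

end

theory Submission
  imports Defs
begin

text \<open>
  Reduction modulo \<open>1 - \<omega>\<^sup>2\<close> is the ring homomorphism \<open>a + b \<omega> \<mapsto> a + b\<close> onto \<open>\<int>/3\<int>\<close>, and
  \<open>N(x) \<equiv> (a + b)\<^sup>2\<close> modulo 3. If \<open>\<alpha>\<close> is odd and norm-perfect, then 3 divides
  \<open>N(\<sigma>(\<alpha>)) = 3 N(\<alpha>)\<close> exactly once, so exactly one factor \<open>1 + \<psi> + \<dots> + \<psi>\<^sup>e\<close> of \<open>\<sigma>(\<alpha>)\<close> is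
  divisible by \<open>1 - \<omega>\<^sup>2\<close>. This sum is \<open>e + 1\<close> for \<open>\<psi> \<equiv> 1\<close>, and 1 or 0 depending on the parity of
  \<open>e\<close> for \<open>\<psi> \<equiv> 2 \<equiv> -1\<close>.
\<close>

text \<open>Kept as an integer instead of a residue class, so that it is exactly additive; only
  multiplicativity needs a congruence modulo 3.\<close>

definition coeff_sum :: "eisenstein \<Rightarrow> int" where
  "coeff_sum x = int_part x + omega_part x"

lemma coeff_sum_simps [simp]:
  "coeff_sum 0 = 0" "coeff_sum 1 = 1"
  "coeff_sum (x + y) = coeff_sum x + coeff_sum y"
  "coeff_sum (x - y) = coeff_sum x - coeff_sum y"
  "coeff_sum (of_nat n) = int n"
  by (simp_all add: coeff_sum_def eisenstein_of_nat)

lemma coeff_sum_sum: "coeff_sum (\<Sum>i\<in>A. f i) = (\<Sum>i\<in>A. coeff_sum (f i))"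
  by (induction A rule: infinite_finite_induct) simp_all

text \<open>The term \<omega>^2 = -1 - \<omega> has coefficient sum -2 where 1 would be wanted, so
  the defect is three times the product of the two \<omega>-coefficients.\<close>

lemma coeff_sum_mult_cong: "[coeff_sum (x * y) = coeff_sum x * coeff_sum y] (mod 3)"
proof -
  have "coeff_sum x * coeff_sum y - coeff_sum (x * y) = 3 * (omega_part x * omega_part y)"
    by (simp add: coeff_sum_def algebra_simps)
  then show ?thesis
    by (metis cong_iff_dvd_diff cong_sym dvd_triv_left)
qed

lemma coeff_sum_power_cong: "[coeff_sum (x ^ n) = coeff_sum x ^ n] (mod 3)"
proof (induction n)
  case (Suc n)
  show ?case
    unfolding power_Suc
    by (intro cong_trans [OF coeff_sum_mult_cong] cong_mult cong_refl Suc.IH)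
qed simp

lemma one_minus_omega_squared_dvd_iff:
  "1 - eisenstein_omega\<^sup>2 dvd x \<longleftrightarrow> 3 dvd coeff_sum x"
proof
  assume "1 - eisenstein_omega\<^sup>2 dvd x"
  then obtain y where y: "x = (1 - eisenstein_omega\<^sup>2) * y" ..
  have "[coeff_sum x = coeff_sum (1 - eisenstein_omega\<^sup>2) * coeff_sum y] (mod 3)"
    unfolding y by (rule coeff_sum_mult_cong)
  moreover have "coeff_sum (1 - eisenstein_omega\<^sup>2) = 3"
    by (simp add: coeff_sum_def power2_eq_square)
  ultimately show "3 dvd coeff_sum x"
    by (metis cong_dvd_iff dvd_triv_left)
next
  assume "3 dvd coeff_sum x"
  then obtain k where "int_part x + omega_part x = 3 * k"
    by (auto simp: coeff_sum_def)
  then have a: "int_part x = 3 * k - omega_part x"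
    by simp
  \<comment> \<open>Here 1 - \<omega>^2 = 2 + \<omega>, and (2 + \<omega>)(k + m \<omega>) = (2k -
    m) + (k + m) \<omega>. The \<omega>-coefficient forces m = \<open>omega_part x - k\<close>; the
    integer part then agrees by \<open>a\<close>.\<close>
  have "x = (1 - eisenstein_omega\<^sup>2) * Eisenstein k (omega_part x - k)"
    by (simp add: eisenstein_eq_iff power2_eq_square a)
  then show "1 - eisenstein_omega\<^sup>2 dvd x"
    by (rule dvdI)
qed

text \<open>Conjugation acts trivially modulo 1 - \<omega>^2, so x times its conjugate reduces to
  the square of the residue of x.\<close>

lemma eisenstein_norm_cong: "[eisenstein_norm x = (coeff_sum x)\<^sup>2] (mod 3)"
proof -
  have "(coeff_sum x)\<^sup>2 - eisenstein_norm x = 3 * (int_part x * omega_part x)"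
    by (simp add: coeff_sum_def eisenstein_norm_def power2_eq_square algebra_simps)
  then show ?thesis
    by (metis cong_iff_dvd_diff cong_sym dvd_triv_left)
qed

lemma three_dvd_eisenstein_norm_iff: "3 dvd eisenstein_norm x \<longleftrightarrow> 3 dvd coeff_sum x"
proof -
  have "3 dvd eisenstein_norm x \<longleftrightarrow> 3 dvd (coeff_sum x)\<^sup>2"
    by (rule cong_dvd_iff [OF eisenstein_norm_cong])
  also have "\<dots> \<longleftrightarrow> 3 dvd coeff_sum x"
    by (simp add: prime_dvd_power_iff)
  finally show ?thesis .
qed

lemma eisenstein_norm_prod: "eisenstein_norm (\<Prod>i\<in>A. f i) = (\<Prod>i\<in>A. eisenstein_norm (f i))"
  by (induction A rule: infinite_finite_induct)
    (simp_all add: eisenstein_norm_mult del: times_eisenstein.simps,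
     simp_all add: eisenstein_norm_def)

lemma coeff_sum_geometric_cong:
  assumes "[coeff_sum x = c] (mod 3)"
  shows "[coeff_sum (\<Sum>i\<le>n. x ^ i) = (\<Sum>i\<le>n. c ^ i)] (mod 3)"
  unfolding coeff_sum_sum
  by (intro cong_sum cong_trans [OF coeff_sum_power_cong] cong_pow assms)

lemma three_dvd_norm_geometric_iff_1:
  assumes "[coeff_sum x = 1] (mod 3)"
  shows "3 dvd eisenstein_norm (\<Sum>i\<le>n. x ^ i) \<longleftrightarrow> [n = 2] (mod 3)"
proof -
  have "3 dvd eisenstein_norm (\<Sum>i\<le>n. x ^ i) \<longleftrightarrow> 3 dvd int n + 1"
    unfolding three_dvd_eisenstein_norm_iff
    using cong_dvd_iff [OF coeff_sum_geometric_cong [OF assms, of n]] by (simp add: add.commute)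
  also have "\<dots> \<longleftrightarrow> [n = 2] (mod 3)"
    unfolding cong_def by presburger
  finally show ?thesis .
qed

lemma three_dvd_norm_geometric_iff_2:
  assumes "[coeff_sum x = 2] (mod 3)"
  shows "3 dvd eisenstein_norm (\<Sum>i\<le>n. x ^ i) \<longleftrightarrow> [n = 1] (mod 2)"
proof -
  \<comment> \<open>With -1 as representative instead of 2, the geometric sum alternates and takes
    only the values 1 and 0.\<close>
  have "[coeff_sum x = - 1] (mod 3)"
    using assms by (simp add: cong_def)
  moreover have "(\<Sum>i\<le>n. (- 1) ^ i) = (if even n then 1 else 0 :: int)"
    by (induction n) auto
  ultimately have "3 dvd eisenstein_norm (\<Sum>i\<le>n. x ^ i) \<longleftrightarrow> odd n"
    unfolding three_dvd_eisenstein_norm_iff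
    using cong_dvd_iff [OF coeff_sum_geometric_cong [of x "- 1" n]] by simp
  then show ?thesis
    by (simp add: cong_def odd_iff_mod_2_eq_one)
qed

text \<open>Primality of p yields one divisible factor. Two of them would put p^2 into the product p
  m, and cancelling p would contradict that p does not divide m.\<close>

lemma ex1_dvd_factor:
  fixes f :: "'a \<Rightarrow> int"
  assumes "finite A" "prime p" "(\<Prod>x\<in>A. f x) = p * m" "\<not> p dvd m"
  shows "\<exists>!x. x \<in> A \<and> p dvd f x"
proof -
  obtain x where x: "x \<in> A" "p dvd f x"
    using assms(1-3) by (metis dvd_triv_left prime_dvd_prod_iff)
  have "y = x" if y: "y \<in> A" "p dvd f y" for y
  proof (rule ccontr)
    assume "y \<noteq> x"
    with x y assms(1) have "(\<Prod>x\<in>A. f x) = f x * (f y * (\<Prod>x\<in>A - {x} - {y}. f x))"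
      by (simp add: prod.remove [of A x] prod.remove [of "A - {x}" y])
    then have "p * p dvd p * m"
      using x y assms(3) by (metis dvd_mult2 mult_dvd_mono)
    with assms(2,4) show False
      by (auto simp: prime_gt_0_int)
  qed
  with x show ?thesis
    by blast
qed

text \<open>A product of normalized primes need not be normalized: 2 + \<omega> is positive, but its
  square 3 + 3 \<omega> is not. Hence only the normal forms of both sides are compared, and
  associatedness supplies the unit.\<close>

lemma prime_factorisation_up_to_unit:
  fixes x :: "'a :: factorial_semiring"
  assumes "x \<noteq> 0"
  obtains u where "is_unit u" "x = u * (\<Prod>p\<in>prime_factors x. p ^ multiplicity p x)"
proof -
  have "(\<Prod>p\<in>prime_factors x. p ^ multiplicity p x) = prod_mset (prime_factorization x)"
    unfolding prod_mset_multiplicity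
    by (intro prod.cong) (simp_all add: count_prime_factorization_prime in_prime_factors_imp_prime)
  then have "normalize x = normalize (\<Prod>p\<in>prime_factors x. p ^ multiplicity p x)"
    using prod_mset_prime_factorization_weak [OF assms] by simp
  then show thesis
    by (rule associatedE1) (rule that)
qed

lemma mem_prime_divisors_mod_iff:
  "\<psi> \<in> prime_divisors_mod j \<alpha> \<longleftrightarrow>
     \<psi> \<in> positive_primes \<and> \<psi> dvd \<alpha> \<and> [coeff_sum \<psi> = int j] (mod 3)"
  by (auto simp: prime_divisors_mod_def one_minus_omega_squared_dvd_iff cong_iff_dvd_diff)

text \<open>Divisors of an odd element are odd, so the residue 0 does not occur and only the classes
  1 and 2 remain.\<close>

lemma prime_divisors_mod_partition:
  assumes "odd_eisenstein \<alpha>"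
  shows "{\<psi> \<in> positive_primes. \<psi> dvd \<alpha>} = prime_divisors_mod 1 \<alpha> \<union> prime_divisors_mod 2 \<alpha>"
    and "prime_divisors_mod 1 \<alpha> \<inter> prime_divisors_mod 2 \<alpha> = {}"
proof -
  have "[coeff_sum \<psi> = 1] (mod 3) \<or> [coeff_sum \<psi> = 2] (mod 3)"
    if "\<psi> dvd \<alpha>" for \<psi>
  proof -
    have "\<not> 3 dvd coeff_sum \<psi>"
      using assms that dvd_trans
      by (auto simp: odd_eisenstein_def simp flip: one_minus_omega_squared_dvd_iff)
    then show ?thesis
      unfolding cong_def by presburger
  qed
  then show "{\<psi> \<in> positive_primes. \<psi> dvd \<alpha>} = prime_divisors_mod 1 \<alpha> \<union> prime_divisors_mod 2 \<alpha>"
    by (simp add: set_eq_iff mem_prime_divisors_mod_iff) blast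
  show "prime_divisors_mod 1 \<alpha> \<inter> prime_divisors_mod 2 \<alpha> = {}"
    by (auto simp: mem_prime_divisors_mod_iff cong_def)
qed

theorem mainTheorem2:
  fixes \<alpha> :: eisenstein
  assumes "odd_eisenstein \<alpha>" and "norm_perfect \<alpha>"
  shows "\<exists>\<epsilon> \<psi>\<^sub>0 k e.
    is_unit \<epsilon> \<and>
    \<alpha> = \<epsilon> * \<psi>\<^sub>0 ^ k *
      (\<Prod>\<psi>\<^sub>1 \<in> prime_divisors_mod 1 \<alpha> - {\<psi>\<^sub>0}. \<psi>\<^sub>1 ^ e \<psi>\<^sub>1) *
      (\<Prod>\<psi>\<^sub>2 \<in> prime_divisors_mod 2 \<alpha> - {\<psi>\<^sub>0}. \<psi>\<^sub>2 ^ e \<psi>\<^sub>2) \<and>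
    (\<psi>\<^sub>0 \<in> prime_divisors_mod 1 \<alpha> \<and> [k = 2] (mod 3) \<or>
     \<psi>\<^sub>0 \<in> prime_divisors_mod 2 \<alpha> \<and> [k = 1] (mod 2)) \<and>
    (\<forall>\<psi>\<^sub>1 \<in> prime_divisors_mod 1 \<alpha> - {\<psi>\<^sub>0}. [e \<psi>\<^sub>1 \<noteq> 2] (mod 3)) \<and>
    (\<forall>\<psi>\<^sub>2 \<in> prime_divisors_mod 2 \<alpha> - {\<psi>\<^sub>0}. [e \<psi>\<^sub>2 = 0] (mod 2))"
proof -
  let ?P = "\<lambda>j. prime_divisors_mod j \<alpha>"
  define S where "S = {\<psi> \<in> positive_primes. \<psi> dvd \<alpha>}"
  define e where "e \<psi> = multiplicity \<psi> \<alpha>" for \<psi>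
  define s where "s \<psi> = (\<Sum>i\<le>e \<psi>. \<psi> ^ i)" for \<psi>
  note S_eq = prime_divisors_mod_partition(1) [OF assms(1), folded S_def]
  have "\<alpha> \<noteq> 0"
    using assms(1) by (auto simp: odd_eisenstein_def)
  have S_factors: "S = prime_factors \<alpha>"
    using \<open>\<alpha> \<noteq> 0\<close> by (auto simp: S_def positive_primes_eq prime_factors_dvd)
  then have "finite S"
    by simp
  have "\<not> 3 dvd eisenstein_norm \<alpha>"
    using assms(1)
    by (simp add: odd_eisenstein_def one_minus_omega_squared_dvd_iff three_dvd_eisenstein_norm_iff)
  have "eisenstein_sigma \<alpha> = (\<Prod>\<psi>\<in>S. s \<psi>)"
    unfolding eisenstein_sigma_def S_def s_def e_def
    \<comment> \<open>The geometric quotient requires \<psi> to differ from 1, which holds because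
      primes are not units.\<close>
    by (intro prod.cong refl eisenstein_geometric_quotient) (auto simp: positive_primes_eq)
  then have "(\<Prod>\<psi>\<in>S. eisenstein_norm (s \<psi>)) = 3 * eisenstein_norm \<alpha>"
    using assms(2) by (simp add: norm_perfect_def flip: eisenstein_norm_prod)
  then have "\<exists>!\<psi>. \<psi> \<in> S \<and> 3 dvd eisenstein_norm (s \<psi>)"
    using \<open>finite S\<close> \<open>\<not> 3 dvd eisenstein_norm \<alpha>\<close> by (intro ex1_dvd_factor) simp_all
  then obtain \<psi>\<^sub>0 where \<psi>\<^sub>0: "\<psi>\<^sub>0 \<in> S" "3 dvd eisenstein_norm (s \<psi>\<^sub>0)"
    and unique: "\<And>\<psi>. \<psi> \<in> S \<Longrightarrow> \<psi> \<noteq> \<psi>\<^sub>0 \<Longrightarrow> \<not> 3 dvd eisenstein_norm (s \<psi>)"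
    by blast
  have dvd_iff_1: "3 dvd eisenstein_norm (s \<psi>) \<longleftrightarrow> [e \<psi> = 2] (mod 3)" if "\<psi> \<in> ?P 1" for \<psi>
    using that three_dvd_norm_geometric_iff_1 by (simp add: mem_prime_divisors_mod_iff s_def)
  have dvd_iff_2: "3 dvd eisenstein_norm (s \<psi>) \<longleftrightarrow> [e \<psi> = 1] (mod 2)" if "\<psi> \<in> ?P 2" for \<psi>
    using that three_dvd_norm_geometric_iff_2 by (simp add: mem_prime_divisors_mod_iff s_def)
  obtain \<epsilon> where "is_unit \<epsilon>" and "\<alpha> = \<epsilon> * (\<Prod>\<psi>\<in>S. \<psi> ^ e \<psi>)"
    using prime_factorisation_up_to_unit [OF \<open>\<alpha> \<noteq> 0\<close>] unfolding S_factors e_def .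
  note this(2)
  \<comment> \<open>\<open>\<psi>\<^sub>0\<close> is split off before the two classes are separated,
    since it may lie in either of them.\<close>
  also have "(\<Prod>\<psi>\<in>S. \<psi> ^ e \<psi>) = \<psi>\<^sub>0 ^ e \<psi>\<^sub>0 * (\<Prod>\<psi>\<in>S - {\<psi>\<^sub>0}. \<psi> ^ e \<psi>)"
    using \<open>finite S\<close> \<psi>\<^sub>0(1) by (rule prod.remove)
  also have "S - {\<psi>\<^sub>0} = (?P 1 - {\<psi>\<^sub>0}) \<union> (?P 2 - {\<psi>\<^sub>0})"
    by (auto simp: S_eq)
  also have "(\<Prod>\<psi>\<in>\<dots>. \<psi> ^ e \<psi>) =
      (\<Prod>\<psi>\<in>?P 1 - {\<psi>\<^sub>0}. \<psi> ^ e \<psi>) * (\<Prod>\<psi>\<in>?P 2 - {\<psi>\<^sub>0}. \<psi> ^ e \<psi>)"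
    using \<open>finite S\<close> prime_divisors_mod_partition(2) [OF assms(1)]
    by (intro prod.union_disjoint) (auto simp: S_eq)
  finally have "\<alpha> = \<epsilon> * \<psi>\<^sub>0 ^ e \<psi>\<^sub>0 *
      (\<Prod>\<psi>\<in>?P 1 - {\<psi>\<^sub>0}. \<psi> ^ e \<psi>) * (\<Prod>\<psi>\<in>?P 2 - {\<psi>\<^sub>0}. \<psi> ^ e \<psi>)"
    by (simp only: mult.assoc)
  moreover note \<open>is_unit \<epsilon>\<close>
  moreover have "\<psi>\<^sub>0 \<in> ?P 1 \<and> [e \<psi>\<^sub>0 = 2] (mod 3) \<or> \<psi>\<^sub>0 \<in> ?P 2 \<and> [e \<psi>\<^sub>0 = 1] (mod 2)"
    using \<psi>\<^sub>0 dvd_iff_1 dvd_iff_2 by (auto simp: S_eq)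
  moreover have "\<forall>\<psi>\<in>?P 1 - {\<psi>\<^sub>0}. [e \<psi> \<noteq> 2] (mod 3)"
    using unique dvd_iff_1 by (auto simp: S_eq)
  moreover have "\<forall>\<psi>\<in>?P 2 - {\<psi>\<^sub>0}. [e \<psi> = 0] (mod 2)"
  proof
    fix \<psi>
    assume "\<psi> \<in> ?P 2 - {\<psi>\<^sub>0}"
    then have "\<not> [e \<psi> = 1] (mod 2)"
      using unique [of \<psi>] dvd_iff_2 [of \<psi>] by (auto simp: S_eq)
    then show "[e \<psi> = 0] (mod 2)"
      by (simp add: cong_def)
  qed
  ultimately show ?thesis
    \<comment> \<open>All exponents are multiplicities in \<alpha>; in particular k is that of
      \<open>\<psi>\<^sub>0\<close>.\<close>
    by (intro exI [of _ \<epsilon>] exI [of _ \<psi>\<^sub>0] exI [of _ "e \<psi>\<^sub>0"] exI [of _ e] conjI)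
qed

end
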